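(* Let $g\in\mathcal{F}_0$. The inversion $(g(x),xg(x))^!$ of the Bell matrix $(g(x),xg(x))$ is the exponential Riordan array $$\left[\left(\frac{1}{x}\operatorname{Rev}(xg(x))\right)_e,\; -x\right].$$
   Context: $R$ is a field of characteristic zero (for concreteness $R=\mathbb{Q}$). $\mathcal{F}_0$ is the set of formal power series $a_0+a_1x+a_2x^2+\cdots\in R[[x]]$ with $a_0\neq 0$, and $\mathcal{F}_1$ is the set of formal power series $a_1x+a_2x^2+\cdots\in R[[x]]$ with $a_1\ne 0$. For $h\in\mathcal{F}_1$, $\operatorname{Rev}(h(x))$ denotes the compositional inverse of $h$, as a power series in $x$. $[x^n]$ denotes extraction of the coefficient of $x^n$. A Riordan array $(g(x),f(x))$ with $g\in\mathcal{F}_0$, $f\in\mathcal{F}_1$ is the lower-triangular matrix $(t_{n,k})_{n,k\ge0}$ with $t_{n,k}=[x^n]g(x)f(x)^k$. Its bivariate generating function is $G(x,y)=\frac{g(x)}{1-yf(x)}\in R[y][[x]]$. A Bell matrix is a Riordan array of the form $(g(x),xg(x))$ with $g\in\mathcal{F}_0$. The inversion $(g(x),f(x))^!$ of a Riordan array is the array $(\hat{t}_{n,k})_{n,k\ge0}$ defined by $\sum_{n,k\ge0}\hat{t}_{n,k}x^ny^k=\frac1x\operatorname{Rev}_x\bigl(xG(x,y)\bigr)$, where $\operatorname{Rev}_x$ denotes the compositional inverse in the variable $x$ (with $y$ fixed): $U(x,y)=\operatorname{Rev}_x(xG(x,y))$ is the unique series in $R[y][[x]]$ with $U(0,y)=0$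 and $U(x,y)\,G(U(x,y),y)=x$. For power series $u=u_0+u_1\frac{x}{1!}+u_2\frac{x^2}{2!}+\cdots$ with $u_0\ne0$ and $v=v_1\frac{x}{1!}+v_2\frac{x^2}{2!}+\cdots$ with $v_1\neq0$, the exponential Riordan array $[u,v]$ is the lower-triangular matrix whose $(n,k)$-th entry ($n,k\ge0$) is $\frac{n!}{k!}[x^n]u(x)v(x)^k$. For an ordinary power series $a(x)=a_0+a_1x+a_2x^2+\cdots\in\mathcal{F}_0$, write $a_e(x)=(a(x))_e=a_0+a_1\frac{x}{1!}+a_2\frac{x^2}{2!}+\cdots$. *)

theory Defs
  imports "HOL-Computational_Algebra.Computational_Algebra"
begin

definition riordan :: "'a::comm_ring_1 fps \<Rightarrow> 'a fps \<Rightarrow> nat \<Rightarrow> nat \<Rightarrow> 'a" where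
  "riordan g f n k = fps_nth (g * f ^ k) n"

definition bell :: "'a::comm_ring_1 fps \<Rightarrow> nat \<Rightarrow> nat \<Rightarrow> 'a" where
  "bell g = riordan g (fps_X * g)"

text \<open>
  The ring $R[y][[x]]$ is rendered as \<^typ>\<open>'a poly fps\<close>, the polynomial variable being $y$.
  The inner sum stops at $k = n$, so this is the full generating function
  $\sum_{n,k} t_{n,k} x^n y^k$ for lower-triangular arrays only.
\<close>

definition bivariate_gf :: "(nat \<Rightarrow> nat \<Rightarrow> 'a::comm_ring_1) \<Rightarrow> 'a poly fps" where
  "bivariate_gf t = Abs_fps (\<lambda>n. \<Sum>k\<le>n. monom (t n k) k)"

text \<open>
  \<^const>\<open>fps_inv\<close> needs coefficients in a field, so the reversion over $R[y]$ is defined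
  by its characteristic property.
\<close>

definition reversion :: "'a::comm_ring_1 fps \<Rightarrow> 'a fps" where
  "reversion F = (THE U. fps_nth U 0 = 0 \<and> F oo U = fps_X)"

text \<open>
  Division by $x$ is \<^term>\<open>fps_shift 1\<close>; the reversion has zero constant term.
\<close>

definition inversion :: "(nat \<Rightarrow> nat \<Rightarrow> 'a::comm_ring_1) \<Rightarrow> nat \<Rightarrow> nat \<Rightarrow> 'a" where
  "inversion t n k =
     poly.coeff (fps_nth (fps_shift 1 (reversion (fps_X * bivariate_gf t))) n) k"

definition exp_riordan :: "'a::field_char_0 fps \<Rightarrow> 'a fps \<Rightarrow> nat \<Rightarrow> nat \<Rightarrow> 'a" where
  "exp_riordan u v n k = fact n / fact k * fps_nth (u * v ^ k) n"

definition to_egf :: "'a::field_char_0 fps \<Rightarrow> 'a fps" where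
  "to_egf a = Abs_fps (\<lambda>n. fps_nth a n / fact n)"


subsection \<open>Adequacy of the definitions\<close>

lemma riordan_eq_0:
  fixes f g :: "'a::comm_ring_1 fps"
  assumes "fps_nth f 0 = 0" "n < k"
  shows "riordan g f n k = 0"
proof -
  have "fps_nth (g * f ^ k) n = (\<Sum>i=0..n. fps_nth g i * fps_nth (f ^ k) (n - i))"
    by (simp add: fps_mult_nth)
  also have "\<dots> = 0"
    using assms by (intro sum.neutral ballI) (simp add: startsby_zero_power_prefix)
  finally show ?thesis by (simp add: riordan_def)
qed

lemma coeff_bivariate_gf_riordan:
  fixes f g :: "'a::comm_ring_1 fps"
  assumes "fps_nth f 0 = 0"
  shows "poly.coeff (fps_nth (bivariate_gf (riordan g f)) n) k = riordan g f n k"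
proof (cases "k \<le> n")
  case True
  then show ?thesis
    by (simp add: bivariate_gf_def coeff_sum)
next
  case False
  then show ?thesis
    using riordan_eq_0[OF assms, of n k g] by (simp add: bivariate_gf_def coeff_sum)
qed

text \<open>The closed form $G(x,y)\,(1 - y f(x)) = g(x)$.\<close>

lemma bivariate_gf_riordan:
  fixes f g :: "'a::comm_ring_1 fps"
  assumes "fps_nth f 0 = 0"
  shows "bivariate_gf (riordan g f) * (1 - fps_const [:0, 1:] * Abs_fps (\<lambda>n. [:fps_nth f n:]))
           = Abs_fps (\<lambda>n. [:fps_nth g n:])"
proof (rule fps_ext, rule poly_eqI)
  fix n k
  let ?G = "bivariate_gf (riordan g f)" and ?f = "Abs_fps (\<lambda>n. [:fps_nth f n:])"
  have "poly.coeff (fps_nth (?G * ?f) n) j = riordan g f n (Suc j)" for j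
  proof -
    have "poly.coeff (fps_nth (?G * ?f) n) j
            = (\<Sum>i=0..n. riordan g f i j * fps_nth f (n - i))"
      by (simp add: fps_mult_nth coeff_sum coeff_bivariate_gf_riordan[OF assms] mult.commute)
    also have "\<dots> = fps_nth (g * f ^ j * f) n"
      by (simp add: fps_mult_nth[of "g * f ^ j"] riordan_def)
    finally show ?thesis
      by (simp add: riordan_def mult_ac)
  qed
  moreover have "?G * (1 - fps_const [:0, 1:] * ?f) = ?G - fps_const [:0, 1:] * (?G * ?f)"
    by (simp add: algebra_simps)
  ultimately show "poly.coeff (fps_nth (?G * (1 - fps_const [:0, 1:] * ?f)) n) k
                     = poly.coeff (fps_nth (Abs_fps (\<lambda>n. [:fps_nth g n:])) n) k"
    by (cases k) (simp_all add: coeff_bivariate_gf_riordan[OF assms] riordan_def coeff_pCons)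
qed

fun left_compinv :: "'a::comm_ring_1 \<Rightarrow> 'a fps \<Rightarrow> nat \<Rightarrow> 'a" where
  "left_compinv c F 0 = 0"
| "left_compinv c F (Suc n) =
     (fps_nth fps_X (Suc n) - (\<Sum>i=0..n. left_compinv c F i * fps_nth (F ^ i) (Suc n))) * c ^ Suc n"

lemma left_compinv:
  fixes F :: "'a::idom fps"
  assumes "fps_nth F 0 = 0" "c * fps_nth F 1 = 1"
  shows "Abs_fps (left_compinv c F) oo F = fps_X"
proof (rule fps_ext)
  fix n
  have c: "c ^ m * fps_nth F 1 ^ m = 1" for m
    using assms(2) by (metis power_mult_distrib power_one)
  show "fps_nth (Abs_fps (left_compinv c F) oo F) n = fps_nth fps_X n"
  proof (cases n)
    case (Suc m)
    have "fps_nth (Abs_fps (left_compinv c F) oo F) n =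
            (\<Sum>i=0..m. left_compinv c F i * fps_nth (F ^ i) n)
            + left_compinv c F (Suc m) * fps_nth F 1 ^ Suc m"
      by (simp only: fps_compose_nth)
         (simp add: Suc startsby_zero_power_nth_same[OF assms(1)] del: power_Suc left_compinv.simps)
    then show ?thesis
      using c[of "Suc m"] by (simp add: Suc mult.assoc del: power_Suc)
  qed (simp add: fps_compose_nth)
qed

lemma ex1_reversion:
  fixes F :: "'a::idom fps"
  assumes F0: "fps_nth F 0 = 0" and F1: "fps_nth F 1 dvd 1"
  shows "\<exists>!U. fps_nth U 0 = 0 \<and> F oo U = fps_X"
proof -
  obtain c where c: "c * fps_nth F 1 = 1"
    using F1 by (metis dvdE mult.commute)
  define V where "V = Abs_fps (left_compinv c F)"
  have V0: "fps_nth V 0 = 0"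
    by (simp add: V_def)
  have V1: "fps_nth F 1 * fps_nth V 1 = 1"
    using c by (simp add: V_def mult.commute)
  have VF: "V oo F = fps_X"
    unfolding V_def by (rule left_compinv[OF F0 c])
  define W where "W = Abs_fps (left_compinv (fps_nth F 1) V)"
  have WV: "W oo V = fps_X"
    unfolding W_def by (rule left_compinv[OF V0 V1])
  have "W = W oo (V oo F)"
    by (simp add: VF)
  also have "\<dots> = F"
    by (simp add: fps_compose_assoc[OF F0 V0] WV F0)
  finally have FV: "F oo V = fps_X"
    using WV by simp
  show ?thesis
  proof (rule ex1I[of _ V])
    fix U
    assume U: "fps_nth U 0 = 0 \<and> F oo U = fps_X"
    then have "U = V oo F oo U"
      by (simp add: VF)
    also have "\<dots> = V"
      using U by (simp add: fps_compose_assoc[OF _ F0, symmetric])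
    finally show "U = V" .
  qed (simp add: V0 FV)
qed

end

theory Submission
  imports Defs
begin

text \<open>
  Write $h = x g$ and let $H$ be its compositional inverse. The series to be reverted is
  $h / (1 - y h)$, so the reversion $U$ satisfies $h(U) = x / (1 + x y)$, that is
  $U = H(x / (1 + x y))$. The coefficient of $x^{n+1} y^k$ in $U$ is therefore
  $(-1)^k {n \choose k} [x^{n-k+1}] H$ by the negative binomial series, which is the
  $(n,k)$ entry of the exponential Riordan array.
\<close>

text \<open>The coefficientwise embedding of R[[x]] into R[y][[x]]. It lets the inverse be formed
  over the field R and carried over to R[y] afterwards.\<close>

definition lift_fps :: "'a::comm_ring_1 fps \<Rightarrow> 'a poly fps" where
  "lift_fps f = Abs_fps (\<lambda>n. [:fps_nth f n:])"

lemma lift_fps_nth [simp]: "fps_nth (lift_fps f) n = [:fps_nth f n:]"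
  by (simp add: lift_fps_def)

lemma lift_fps_X [simp]: "lift_fps fps_X = fps_X"
  by (rule fps_ext) (simp add: fps_X_def)

lemma sum_const_poly: "(\<Sum>i\<in>A. [:f i:]) = [:\<Sum>i\<in>A. f i:]"
  by (rule poly_eqI) (simp add: coeff_sum coeff_pCons split: nat.split)

lemma lift_fps_mult: "lift_fps (f * g) = lift_fps f * lift_fps g"
  by (rule fps_ext) (simp add: fps_mult_nth sum_const_poly mult.commute)

lemma lift_fps_power: "lift_fps (f ^ n) = lift_fps f ^ n"
proof (induction n)
  case 0
  show ?case by (rule fps_ext) simp
qed (simp add: lift_fps_mult)

lemma lift_fps_compose: "lift_fps (f oo g) = lift_fps f oo lift_fps g"
  by (rule fps_ext)
     (simp add: fps_compose_nth lift_fps_power[symmetric] sum_const_poly mult.commute)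

text \<open>The expansion of $(1 + x y)^{-(m+1)}$.\<close>

definition neg_binomial_fps :: "nat \<Rightarrow> 'a::comm_ring_1 poly fps" where
  "neg_binomial_fps m = Abs_fps (\<lambda>n. monom ((-1) ^ n * of_nat ((n + m) choose m)) n)"

abbreviation one_plus_xy :: "'a::comm_ring_1 poly fps" where
  "one_plus_xy \<equiv> 1 + fps_const [:0, 1:] * fps_X"

lemma monom_eq_y_mult: "[:0, 1:] * monom c n = monom (c::'a::comm_ring_1) (Suc n)"
  by (simp add: monom_Suc)

lemma one_plus_xy_mult_nth:
  "fps_nth (one_plus_xy * f) n =
     fps_nth f n + (if n = 0 then 0 else [:0, 1:] * fps_nth f (n - 1))"
  by (simp add: distrib_right mult.assoc)

text \<open>For n > 0 the terms (-1)^n y^n and y (-1)^(n-1) y^(n-1) cancel.\<close>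

lemma neg_binomial_fps_0: "one_plus_xy * neg_binomial_fps 0 = 1"
proof (rule fps_ext)
  fix n
  show "fps_nth (one_plus_xy * neg_binomial_fps 0) n = fps_nth (1 :: 'a poly fps) n"
    unfolding one_plus_xy_mult_nth
    \<comment> \<open>Deleting \<open>mult_pCons_left\<close> keeps the factor y unexpanded, so that
      \<open>monom_eq_y_mult\<close> can absorb it.\<close>
    by (cases n) (simp_all add: neg_binomial_fps_def monom_eq_y_mult add_monom
      del: mult_pCons_left)
qed

text \<open>Coefficientwise this is Pascal's rule.\<close>

lemma neg_binomial_fps_Suc:
  "one_plus_xy * neg_binomial_fps (Suc m) = neg_binomial_fps m"
proof (rule fps_ext)
  fix n
  show "fps_nth (one_plus_xy * neg_binomial_fps (Suc m)) n
          = fps_nth (neg_binomial_fps m :: 'a poly fps) n"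
    unfolding one_plus_xy_mult_nth
    by (cases n) (simp_all add: neg_binomial_fps_def monom_eq_y_mult add_monom binomial_eq_0
      algebra_simps del: mult_pCons_left)
qed

lemma neg_binomial_fps_eq_power:
  "neg_binomial_fps m = (neg_binomial_fps 0 :: 'a::comm_ring_1 poly fps) ^ Suc m"
proof (induction m)
  case (Suc m)
  have "neg_binomial_fps (Suc m) =
          (one_plus_xy * neg_binomial_fps 0) * (neg_binomial_fps (Suc m) :: 'a poly fps)"
    by (simp only: neg_binomial_fps_0 mult_1_left)
  also have "\<dots> = neg_binomial_fps 0 * (one_plus_xy * neg_binomial_fps (Suc m))"
    by (simp only: mult_ac)
  finally show ?case
    unfolding neg_binomial_fps_Suc using Suc by simp
qed simp

lemma reversion_bell_gf:
  fixes g :: "'a::field fps"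
  assumes "fps_nth g 0 \<noteq> 0"
  shows "reversion (fps_X * bivariate_gf (bell g))
           = lift_fps (fps_inv (fps_X * g)) oo (fps_X * neg_binomial_fps 0)"
proof -
  define h where "h = fps_X * g"
  define H where "H = fps_inv h"
  define F where "F = fps_X * bivariate_gf (bell g)"
  \<comment> \<open>\<open>P\<close> is x / (1 + x y).\<close>
  define P :: "'a poly fps" where "P = fps_X * neg_binomial_fps 0"
  define U where "U = lift_fps H oo P"
  have h0: "fps_nth h 0 = 0" and h1: "fps_nth h 1 \<noteq> 0"
    using assms by (simp_all add: h_def)
  have H0: "fps_nth H 0 = 0"
    by (simp add: H_def fps_inv_def)
  have P0: "fps_nth P 0 = 0"
    by (simp add: P_def)
  have U0: "fps_nth U 0 = 0"
    by (simp add: U_def H0)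
  have P: "one_plus_xy * P = fps_X"
    using neg_binomial_fps_0[where 'a = 'a] by (simp add: P_def mult.left_commute)
  have hU: "lift_fps h oo U = P"
  proof -
    have "lift_fps h oo U = (lift_fps h oo lift_fps H) oo P"
      by (simp add: U_def fps_compose_assoc P0 H0)
    also have "lift_fps h oo lift_fps H = fps_X"
      using fps_inv_right[OF h0 h1] by (simp add: H_def flip: lift_fps_compose)
    finally show ?thesis
      by (simp add: P0)
  qed
  have F: "F * (1 - fps_const [:0, 1:] * lift_fps h) = lift_fps h"
    unfolding F_def bell_def h_def[symmetric] mult.assoc
      bivariate_gf_riordan[OF h0, folded lift_fps_def]
    by (simp add: h_def lift_fps_mult)
  have "(F * (1 - fps_const [:0, 1:] * lift_fps h)) oo U = P"
    by (simp add: F hU)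
  then have FU: "(F oo U) * (1 - fps_const [:0, 1:] * P) = P"
    by (simp add: fps_compose_mult_distrib[OF U0] fps_compose_sub_distrib hU)
  \<comment> \<open>Clearing the denominator: since (1 + x y) P = x, the left factor becomes 1 + x y
    - x y = 1.\<close>
  have "(F oo U) * (one_plus_xy - fps_const [:0, 1:] * (one_plus_xy * P))
          = one_plus_xy * ((F oo U) * (1 - fps_const [:0, 1:] * P))"
    by (simp add: algebra_simps)
  then have "F oo U = fps_X"
    unfolding FU P by simp
  \<comment> \<open>\<open>reversion\<close> is a definite description, so uniqueness is required as
    well. The linear coefficient of \<open>F\<close> is a nonzero constant, hence a unit of
    R[y].\<close>
  moreover have "\<exists>!U. fps_nth U 0 = 0 \<and> F oo U = fps_X"
  proof (rule ex1_reversion)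
    have "fps_nth F 1 = [:fps_nth g 0:]"
      by (simp add: F_def bivariate_gf_def bell_def riordan_def monom_0)
    then show "fps_nth F 1 dvd 1"
      using assms by (simp add: is_unit_const_poly_iff dvd_field_iff)
  qed (simp add: F_def)
  ultimately have "reversion F = U"
    unfolding reversion_def using U0 by (intro the1_equality) auto
  then show ?thesis
    by (simp add: F_def U_def P_def H_def h_def)
qed

text \<open>The power x^(i+1) / (1 + x y)^(i+1) contributes to x^(n+1) a single monomial in y, of
  degree n - i, so only i = n - k survives. The zeroth power contributes nothing.\<close>

lemma coeff_compose_neg_binomial_fps:
  fixes f :: "'a::comm_ring_1 fps"
  shows "poly.coeff (fps_nth (lift_fps f oo (fps_X * neg_binomial_fps 0)) (Suc n)) k =
    (if k \<le> n then (-1) ^ k * of_nat (n choose k) * fps_nth f (Suc (n - k)) else 0)"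
proof -
  have pow: "fps_nth ((fps_X * neg_binomial_fps 0) ^ Suc i) (Suc n)
          = (monom ((-1) ^ (n - i) * of_nat (n choose i)) (n - i) :: 'a poly)"
    if "i \<le> n" for i
    unfolding power_mult_distrib neg_binomial_fps_eq_power[symmetric] using that
    by (simp add: fps_X_power_mult_nth neg_binomial_fps_def del: power_Suc)
  have "poly.coeff (fps_nth (lift_fps f oo (fps_X * neg_binomial_fps 0)) (Suc n)) k
      = (\<Sum>i\<le>n. poly.coeff ([:fps_nth f (Suc i):] *
           fps_nth ((fps_X * neg_binomial_fps 0) ^ Suc i) (Suc n)) k)"
    by (simp add: fps_compose_nth coeff_sum atLeast0AtMost sum.atMost_Suc_shift
      del: power_Suc sum.atMost_Suc)
  also have "\<dots> = (\<Sum>i\<le>n. if n - i = k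
      then fps_nth f (Suc i) * ((-1) ^ (n - i) * of_nat (n choose i)) else 0)"
    by (intro sum.cong refl) (simp add: pow del: power_Suc)
  also have "\<dots> = (\<Sum>j\<le>n. if j = k
      then fps_nth f (Suc (n - j)) * ((-1) ^ j * of_nat (n choose (n - j))) else 0)"
    by (rule sum.reindex_bij_witness[of _ "\<lambda>j. n - j" "\<lambda>j. n - j"]) auto
  also have "\<dots> = (if k \<le> n
      then (-1) ^ k * of_nat (n choose k) * fps_nth f (Suc (n - k)) else 0)"
    by (simp add: binomial_symmetric[symmetric] mult_ac)
  finally show ?thesis .
qed

text \<open>The factor (-x)^k shifts the index to n - k, and n! / (k! (n-k)!) is the binomial
  coefficient.\<close>

lemma exp_riordan_to_egf_uminus_X:
  "exp_riordan (to_egf a) (- fps_X) n k =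
     (if k \<le> n then (-1) ^ k * of_nat (n choose k) * fps_nth a (n - k) else 0)"
proof -
  have "to_egf a * (- fps_X) ^ k = fps_const ((-1) ^ k) * (to_egf a * fps_X ^ k)"
    by (subst power_minus) (simp add: mult_ac flip: fps_const_power fps_const_neg)
  then show ?thesis
    unfolding exp_riordan_def
    by (simp only: fps_mult_left_const_nth fps_X_power_mult_right_nth)
       (simp add: to_egf_def binomial_fact field_simps)
qed

theorem proposition11:
  fixes g :: "'a::field_char_0 fps"
  assumes "fps_nth g 0 \<noteq> 0"
  shows "inversion (bell g)
           = exp_riordan (to_egf (fps_shift 1 (fps_inv (fps_X * g)))) (- fps_X)"
  \<comment> \<open>Both closed forms agree, since \<open>fps_shift 1\<close> turns index n - k into
    \<open>Suc (n - k)\<close>.\<close>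
  by (intro ext) (simp add: inversion_def reversion_bell_gf[OF assms]
    coeff_compose_neg_binomial_fps exp_riordan_to_egf_uminus_X)

end
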